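(* For every topological model $\mathcal{M}=((X,\tau),\nu)$ and every modal formula $\varphi$: $$\llbracket\Diamond_{\mathrm{ns}}\Diamond_{\mathrm{ns}}\varphi\rrbracket\subseteq\llbracket\Diamond_{\mathrm{ns}}\varphi\rrbracket.$$
   Context: Nonstandard setting. For a topological space $(X,\tau)$ let $S=X\cup\mathbb{R}$ and let $V(S)=\bigcup_{k\in\mathbb{N}_0}V_k(S)$ be the superstructure over $S$, where $V_0(S)=S$ and $V_{k+1}(S)=V_k(S)\cup\mathcal{P}(V_k(S))$. A polysaturated nonstandard model is a superstructure $V({}^*S)$ with a star map $A\mapsto{}^*A$ from $V(S)$ to $V({}^*S)$ such that: (1) Extension: ${}^*s=s$ for all $s\in S$; (2) Transfer: a bounded quantifier formula $\Phi(A_1,\dots,A_n)$ is true in $V(S)$ iff $\Phi({}^*A_1,\dots,{}^*A_n)$ is true in $V({}^*S)$; (3) Saturation: every family of internal sets of cardinality at most $\kappa$ with the finite intersection property has non-empty intersection, where $\kappa\ge|V(S)|$ is a fixed cardinal. A set is internal if it is an element of ${}^*C$ for some $C\in V(S)$. One such model is fixed throughout. In particular $X\subseteq{}^*X$. Halo. For $x\in X$, $\mathcal{N}(x)=\{U\in\tau: x\in U\}$ and $\mu(x)=\bigcap_{U\in\mathcal{N}(x)}{}^*U$. Modal semantics. Formulas are built from propositional variables, $\bot$, $\neg$, $\wedge$ and a unary $\Diamond_{\mathrm{ns}}$. A topological model is $\mathcal{M}=((X,\tau),\nu)$ with $(X,\tau)$ a topological space and $\nu$ a map from propositional variables to $\mathcal{P}(X)$.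 The extension $\llbracket\varphi\rrbracket\subseteq X$ is defined with $\llbracket p\rrbracket=\nu(p)$, Boolean clauses as usual, and $\llbracket\Diamond_{\mathrm{ns}}\varphi\rrbracket=\{x\in X:\mu(x)\cap({}^*\llbracket\varphi\rrbracket\setminus X)\neq\emptyset\}$. *)

theory Defs
  imports "HOL-Analysis.Abstract_Topology"
begin

unbundle cardinal_syntax

section \<open>Superstructures and star maps\<close>

text \<open>
  HOL has no type containing all finite levels of a superstructure over an arbitrary base set, so
  superstructures live in an arbitrary type \<open>'u\<close> of individuals and sets, with membership
  relation \<open>mem\<close>.  The elements of \<open>At\<close> are individuals (atoms), all other elements of \<open>'u\<close> are sets.
  Both superstructures, over \<open>S\<close> and over \<open>*S\<close>, are taken in the same type, so that
  inclusions such as \<open>X \<subseteq> *X\<close> hold literally.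
\<close>

datatype bformula =
    BEq nat nat
  | BMem nat nat
  | BNeg bformula
  | BAnd bformula bformula
  | BAll nat nat bformula  \<comment> \<open>\<open>BAll i j \<Phi>\<close> is \<open>\<forall>x\<^sub>i \<in> x\<^sub>j. \<Phi>\<close>\<close>

datatype 'p modal_formula =
    Var 'p
  | Bot
  | Neg "'p modal_formula"
  | Conj "'p modal_formula" "'p modal_formula"
  | Dia "'p modal_formula"

locale star_frame =
  fixes mem :: "'u \<Rightarrow> 'u \<Rightarrow> bool"
    and At :: "'u set"
    and star :: "'u \<Rightarrow> 'u"
begin

definition elts :: "'u \<Rightarrow> 'u set" where
  "elts u = {x. mem x u}"

primrec level :: "'u set \<Rightarrow> nat \<Rightarrow> 'u set" where
  "level B 0 = B"
| "level B (Suc k) = level B k \<union> {u. u \<notin> At \<and> elts u \<subseteq> level B k}"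

definition superstructure :: "'u set \<Rightarrow> 'u set" where
  "superstructure B = (\<Union>k. level B k)"

text \<open>
  The second conjunct makes the power sets in \<^const>\<open>level\<close> full: every HOL set of objects of
  the same level is represented by an object.
\<close>

definition superstructure_base :: "'u set \<Rightarrow> bool" where
  "superstructure_base B \<longleftrightarrow>
     B \<subseteq> At \<and> (\<forall>k. \<forall>A \<subseteq> level B k. \<exists>u. u \<notin> At \<and> elts u = A)"

definition obj :: "'u set \<Rightarrow> 'u" where
  "obj A = (THE u. u \<notin> At \<and> elts u = A)"

definition star_set :: "'u set \<Rightarrow> 'u set" where
  "star_set A = elts (star (obj A))"

text \<open>Truth of a bounded quantifier formula in the structure with domain \<open>M\<close>.\<close>

primrec sat :: "'u set \<Rightarrow> (nat \<Rightarrow> 'u) \<Rightarrow> bformula \<Rightarrow> bool" where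
  "sat M e (BEq i j) \<longleftrightarrow> e i = e j"
| "sat M e (BMem i j) \<longleftrightarrow> mem (e i) (e j)"
| "sat M e (BNeg \<Phi>) \<longleftrightarrow> \<not> sat M e \<Phi>"
| "sat M e (BAnd \<Phi> \<Psi>) \<longleftrightarrow> sat M e \<Phi> \<and> sat M e \<Psi>"
| "sat M e (BAll i j \<Phi>) \<longleftrightarrow> (\<forall>a\<in>M. mem a (e j) \<longrightarrow> sat M (e(i := a)) \<Phi>)"

definition internal_set :: "'u set \<Rightarrow> 'u \<Rightarrow> bool" where
  "internal_set S u \<longleftrightarrow> u \<notin> At \<and> (\<exists>C \<in> superstructure S. mem u (star C))"

definition halo :: "'u topology \<Rightarrow> 'u \<Rightarrow> 'u set" where
  "halo T x = (\<Inter>U \<in> {U. openin T U \<and> x \<in> U}. star_set U)"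

primrec extension :: "'u topology \<Rightarrow> ('p \<Rightarrow> 'u set) \<Rightarrow> 'p modal_formula \<Rightarrow> 'u set" where
  "extension T \<nu> (Var p) = \<nu> p"
| "extension T \<nu> Bot = {}"
| "extension T \<nu> (Neg \<phi>) = topspace T - extension T \<nu> \<phi>"
| "extension T \<nu> (Conj \<phi> \<psi>) = extension T \<nu> \<phi> \<inter> extension T \<nu> \<psi>"
| "extension T \<nu> (Dia \<phi>) =
     {x \<in> topspace T. halo T x \<inter> (star_set (extension T \<nu> \<phi>) - topspace T) \<noteq> {}}"

end

section \<open>Polysaturated nonstandard models\<close>

text \<open>
  The base set is \<open>S = X \<union> \<real>\<close>, where the real numbers are the image of an injection
  \<open>rl\<close> into the atoms; overlaps of \<open>X\<close> and \<open>\<real>\<close> are allowed.  The cardinal \<open>\<kappa>\<close> is given as a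
  cardinal order on an arbitrary type.
\<close>

locale polysaturated_model = star_frame mem At star
  for mem :: "'u \<Rightarrow> 'u \<Rightarrow> bool" and At :: "'u set" and star :: "'u \<Rightarrow> 'u" +
  fixes T :: "'u topology"
    and rl :: "real \<Rightarrow> 'u"
    and S :: "'u set"
    and \<kappa> :: "'k rel"
  assumes atom_no_elts: "a \<in> At \<Longrightarrow> elts a = {}"
    and extensionality: "u \<notin> At \<Longrightarrow> v \<notin> At \<Longrightarrow> elts u = elts v \<Longrightarrow> u = v"
    and inj_rl: "inj rl"
    and S_eq: "S = topspace T \<union> range rl"
    and base: "superstructure_base S"
    and star_base: "superstructure_base (star_set S)"
    and star_mem: "A \<in> superstructure S \<Longrightarrow> star A \<in> superstructure (star_set S)"
    and star_extension: "s \<in> S \<Longrightarrow> star s = s"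
    and transfer_principle:
      "(\<And>i. e i \<in> superstructure S) \<Longrightarrow>
         sat (superstructure S) e \<Phi> \<longleftrightarrow> sat (superstructure (star_set S)) (\<lambda>i. star (e i)) \<Phi>"
    and card_order: "Card_order \<kappa>"
    and card_ge: "|superstructure S| \<le>o \<kappa>"
    and saturation:
      "\<lbrakk>F \<noteq> {}; \<And>u. u \<in> F \<Longrightarrow> internal_set S u; |F| \<le>o \<kappa>;
        \<And>G. \<lbrakk>G \<subseteq> F; finite G; G \<noteq> {}\<rbrakk> \<Longrightarrow> (\<Inter>u\<in>G. elts u) \<noteq> {}\<rbrakk>
         \<Longrightarrow> (\<Inter>u\<in>F. elts u) \<noteq> {}"

end

theory Submission
  imports Defs
begin

text \<open>
  Saturation turns the halo condition into a condition on single neighbourhoods: for a set \<open>A\<close> of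
  standard points, \<open>\<mu>(x)\<close> meets \<open>*A - X\<close> if and only if \<open>*U\<close> meets \<open>*A - X\<close> for every open
  neighbourhood \<open>U\<close> of \<open>x\<close> (lemma \<open>halo_meets_nonstandard_iff\<close>; informally, every neighbourhood
  of \<open>x\<close> contains infinitely many points of \<open>A\<close>).

  The right-hand side mentions \<open>x\<close> only through its open neighbourhoods, and an open set is a
  neighbourhood of each of its points.  This gives the inclusion.  Let \<open>A\<close> be the extension of
  \<open>\<phi>\<close>, let \<open>B\<close> be the extension of \<open>\<diamond>\<phi>\<close>, and let \<open>x\<close> be a point of the extension of
  \<open>\<diamond>\<diamond>\<phi>\<close> with open neighbourhood \<open>U\<close>.  The halo of \<open>x\<close> lies in \<open>*U\<close>, so \<open>*U\<close> meets \<open>*B\<close>, and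
  by transfer \<open>U\<close> contains some \<open>y \<in> B\<close>.  The halo of \<open>y\<close> also lies in \<open>*U\<close>, and it meets
  \<open>*A - X\<close>; hence \<open>*U\<close> meets \<open>*A - X\<close>.
\<close>

section \<open>Transfer for sets of individuals\<close>

context polysaturated_model
begin

lemma superstructure_transitive:
  assumes "B \<subseteq> At" and "u \<in> superstructure B" and "mem x u"
  shows "x \<in> superstructure B"
proof -
  from assms(2) obtain k where "u \<in> level B k"
    by (auto simp: superstructure_def)
  then have "x \<in> level B k"
    using assms(1,3) atom_no_elts by (induction k) (auto simp: elts_def)
  then show ?thesis
    by (auto simp: superstructure_def)
qed

lemma obj_of_subset_level:
  assumes "A \<subseteq> level S k"
  shows "obj A \<notin> At" and "elts (obj A) = A"
proof -
  obtain u where u: "u \<notin> At" "elts u = A"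
    using base assms unfolding superstructure_base_def by blast
  then have "obj A = u"
    unfolding obj_def using extensionality by (intro the_equality) auto
  with u show "obj A \<notin> At" and "elts (obj A) = A"
    by auto
qed

lemma obj_in_next_level:
  assumes "A \<subseteq> level S k"
  shows "obj A \<in> level S (Suc k)"
  using obj_of_subset_level[OF assms] assms by simp

lemma obj_in_superstructure:
  assumes "A \<subseteq> level S k"
  shows "obj A \<in> superstructure S"
  unfolding superstructure_def using obj_in_next_level[OF assms] by blast

lemma individual_in_superstructure: "s \<in> S \<Longrightarrow> s \<in> superstructure S"
  by (auto simp: superstructure_def intro: exI[of _ 0])

lemma mem_obj_iff: "A \<subseteq> S \<Longrightarrow> mem x (obj A) \<longleftrightarrow> x \<in> A"
  using obj_of_subset_level(2)[of A 0] by (auto simp: elts_def)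

lemma mem_star_obj_iff: "mem x (star (obj A)) \<longleftrightarrow> x \<in> star_set A"
  by (simp add: star_set_def elts_def)

text \<open>
  The bounded quantifiers of a transferred formula range over the whole of \<open>*A\<close> because the
  superstructure over \<open>*S\<close> is transitive.
\<close>

lemma star_set_in_superstructure:
  assumes "A \<subseteq> S" and "x \<in> star_set A"
  shows "x \<in> superstructure (star_set S)"
proof (rule superstructure_transitive)
  show "star_set S \<subseteq> At"
    using star_base by (simp add: superstructure_base_def)
  show "star (obj A) \<in> superstructure (star_set S)"
    using assms(1) by (intro star_mem obj_in_superstructure[of A 0]) simp
  show "mem x (star (obj A))"
    using assms(2) by (simp add: mem_star_obj_iff)
qed

lemma standard_mem_star_set_iff:
  assumes "A \<subseteq> S" and "s \<in> S"
  shows "s \<in> star_set A \<longleftrightarrow> s \<in> A"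
proof -
  have "sat (superstructure S) (\<lambda>i. if i = 0 then s else obj A) (BMem 0 1) \<longleftrightarrow>
        sat (superstructure (star_set S))
          (\<lambda>i. star (if i = 0 then s else obj A)) (BMem 0 1)"
    using assms individual_in_superstructure obj_in_superstructure[of A 0]
    by (intro transfer_principle) auto
  then show ?thesis
    using assms by (simp add: star_extension mem_obj_iff mem_star_obj_iff)
qed

lemma star_set_disjoint:
  assumes "A \<subseteq> S" and "B \<subseteq> S" and "A \<inter> B = {}"
  shows "star_set A \<inter> star_set B = {}"
proof -
  let ?e = "\<lambda>i::nat. if i = 0 then obj A else obj B"
  let ?\<Phi> = "BAll 2 0 (BNeg (BMem 2 1))"
  have "sat (superstructure S) ?e ?\<Phi> \<longleftrightarrow>
        sat (superstructure (star_set S)) (\<lambda>i. star (?e i)) ?\<Phi>"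
    using assms obj_in_superstructure[of _ 0] by (intro transfer_principle) auto
  moreover have "sat (superstructure S) ?e ?\<Phi>"
    using assms by (auto simp: mem_obj_iff)
  ultimately show ?thesis
    using assms(1) by (auto simp: mem_star_obj_iff dest: star_set_in_superstructure)
qed

text \<open>
  Taken together with \<open>standard_mem_star_set_iff\<close>, the following instance of transfer covers both
  the monotonicity of the star map (with \<open>z \<in> C\<close>) and the removal of a standard point.
\<close>

lemma star_set_Int_subset_insert:
  assumes "A \<subseteq> S" and "B \<subseteq> S" and "C \<subseteq> S" and "z \<in> S" and "A \<inter> B \<subseteq> insert z C"
  shows "star_set A \<inter> star_set B \<subseteq> insert z (star_set C)"
proof -
  let ?e = "\<lambda>i::nat. if i = 0 then obj A else if i = 1 then obj B
                     else if i = 2 then obj C else z"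
  let ?\<Phi> = "BAll 4 0 (BNeg (BAnd (BMem 4 1) (BAnd (BNeg (BEq 4 3)) (BNeg (BMem 4 2)))))"
  have "sat (superstructure S) ?e ?\<Phi> \<longleftrightarrow>
        sat (superstructure (star_set S)) (\<lambda>i. star (?e i)) ?\<Phi>"
    using assms individual_in_superstructure obj_in_superstructure[of _ 0]
    by (intro transfer_principle) auto
  moreover have "sat (superstructure S) ?e ?\<Phi>"
    using assms by (auto simp: mem_obj_iff)
  ultimately show ?thesis
    using assms(1,4)
    by (auto simp: mem_star_obj_iff star_extension dest: star_set_in_superstructure)
qed

lemma star_set_mono:
  assumes "A \<subseteq> B" and "B \<subseteq> S"
  shows "star_set A \<subseteq> star_set B"
proof (cases "B = {}")
  case True
  with assms show ?thesis by simp
next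
  case False
  then obtain z where z: "z \<in> B" by blast
  have "star_set A \<inter> star_set A \<subseteq> insert z (star_set B)"
    using assms z by (intro star_set_Int_subset_insert) auto
  moreover have "z \<in> star_set B"
    using assms z standard_mem_star_set_iff by blast
  ultimately show ?thesis by blast
qed

text \<open>
  Individuals have no elements, so a nonempty \<open>*A\<close> comes from a set and not from an individual;
  it is internal because \<open>A \<in> {A}\<close> transfers to \<open>*A \<in> *{A}\<close>.
\<close>

lemma internal_set_star_obj:
  assumes "A \<subseteq> S" and "star_set A \<noteq> {}"
  shows "internal_set S (star (obj A))"
proof -
  have lvl: "{obj A} \<subseteq> level S 1"
    using obj_in_next_level[of A 0] assms(1) by simp
  let ?e = "\<lambda>i::nat. if i = 0 then obj A else obj {obj A}"
  have "sat (superstructure S) ?e (BMem 0 1) \<longleftrightarrow>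
        sat (superstructure (star_set S)) (\<lambda>i. star (?e i)) (BMem 0 1)"
    using assms(1) obj_in_superstructure[of A 0] obj_in_superstructure[OF lvl]
    by (intro transfer_principle) auto
  moreover have "mem (obj A) (obj {obj A})"
    using obj_of_subset_level(2)[OF lvl] by (auto simp: elts_def)
  ultimately have "mem (star (obj A)) (star (obj {obj A}))"
    by simp
  moreover have "star (obj A) \<notin> At"
    using assms(2) atom_no_elts by (auto simp: star_set_def)
  ultimately show ?thesis
    using obj_in_superstructure[OF lvl] by (auto simp: internal_set_def)
qed

section \<open>Halos and saturation\<close>

lemma topspace_subset_S: "topspace T \<subseteq> S"
  using S_eq by blast

lemma halo_subset_star_set: "openin T U \<Longrightarrow> x \<in> U \<Longrightarrow> halo T x \<subseteq> star_set U"
  by (auto simp: halo_def)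

text \<open>
  The set \<open>*A - X\<close> is external in general, so saturation cannot be applied to it directly.
  Removing standard points one at a time keeps the sets internal: saturation is applied to the sets
  \<open>*(U \<inter> A - {z})\<close> for all open neighbourhoods \<open>U\<close> of \<open>x\<close> and all \<open>z \<in> X\<close>, whose common elements
  lie in \<open>\<mu>(x) \<inter> (*A - X)\<close>.  Finitely many of these sets have a common element because an element
  of \<open>*W \<inter> *A - X\<close>, for \<open>W\<close> the intersection of the neighbourhoods involved, lies in all of them.
\<close>

lemma halo_meets_nonstandard_iff:
  assumes x: "x \<in> topspace T" and A: "A \<subseteq> topspace T"
  shows "halo T x \<inter> (star_set A - topspace T) \<noteq> {} \<longleftrightarrow>
         (\<forall>U. openin T U \<and> x \<in> U \<longrightarrow> star_set U \<inter> (star_set A - topspace T) \<noteq> {})"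
    (is "?L \<longleftrightarrow> ?R")
proof
  assume ?L
  then show ?R
    using halo_subset_star_set by blast
next
  assume R: ?R
  define P where "P = {U. openin T U \<and> x \<in> U} \<times> topspace T"
  define D where "D p = fst p \<inter> A - {snd p}" for p
  define F where "F = (\<lambda>p. star (obj (D p))) ` P"
  have DX: "D p \<subseteq> topspace T" for p
    using A by (auto simp: D_def)
  then have DS: "D p \<subseteq> S" for p
    using topspace_subset_S by blast
  have elts_F: "elts (star (obj (D p))) = star_set (D p)" for p
    by (simp add: star_set_def)
  have fip: "(\<Inter>p\<in>Q. star_set (D p)) \<noteq> {}" if Q: "Q \<subseteq> P" "finite Q" "Q \<noteq> {}" for Q
  proof -
    define W where "W = (\<Inter>p\<in>Q. fst p)"
    have "openin T W"
      unfolding W_def using Q by (intro openin_Inter) (auto simp: P_def)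
    moreover have "x \<in> W"
      using Q by (auto simp: W_def P_def)
    ultimately obtain w where w: "w \<in> star_set W" "w \<in> star_set A" "w \<notin> topspace T"
      using R by blast
    have "w \<in> star_set (D p)" if p: "p \<in> Q" for p
    proof -
      have "W \<subseteq> S"
        using \<open>openin T W\<close> openin_subset topspace_subset_S by blast
      moreover have "snd p \<in> topspace T"
        using p Q by (auto simp: P_def)
      moreover have "W \<inter> A \<subseteq> insert (snd p) (D p)"
        using p by (auto simp: W_def D_def)
      ultimately have "star_set W \<inter> star_set A \<subseteq> insert (snd p) (star_set (D p))"
        using A DS topspace_subset_S by (intro star_set_Int_subset_insert) auto
      with w \<open>snd p \<in> topspace T\<close> show ?thesis by blast
    qed
    then show ?thesis by blast
  qed
  have "(\<Inter>u\<in>F. elts u) \<noteq> {}"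
  proof (rule saturation)
    show "F \<noteq> {}"
      using x by (auto simp: F_def P_def intro: exI[of _ "topspace T"])
    show "internal_set S u" if "u \<in> F" for u
    proof -
      from that obtain p where p: "p \<in> P" "u = star (obj (D p))"
        by (auto simp: F_def)
      then have "star_set (D p) \<noteq> {}"
        using fip[of "{p}"] by simp
      with p show ?thesis
        using internal_set_star_obj DS by simp
    qed
    have "F \<subseteq> star ` superstructure S"
      using obj_in_superstructure[of _ 0] DS by (auto simp: F_def)
    then have "|F| \<le>o |star ` superstructure S|"
      by (rule card_of_mono1)
    also have "|star ` superstructure S| \<le>o |superstructure S|"
      by (rule card_of_image)
    also have "|superstructure S| \<le>o \<kappa>"
      by (rule card_ge)
    finally show "|F| \<le>o \<kappa>" .
    show "(\<Inter>u\<in>G. elts u) \<noteq> {}" if G: "G \<subseteq> F" "finite G" "G \<noteq> {}" for G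
    proof -
      obtain Q where "Q \<subseteq> P" "finite Q" "G = (\<lambda>p. star (obj (D p))) ` Q"
        using finite_subset_image[OF G(2) G(1)[unfolded F_def]] by blast
      then show ?thesis
        using fip[of Q] G(3) by (simp add: elts_F)
    qed
  qed
  then obtain v where vP: "\<forall>p\<in>P. v \<in> star_set (D p)"
    unfolding F_def using elts_F by auto
  have v: "v \<in> star_set (D (U, z))"
    if "openin T U" "x \<in> U" "z \<in> topspace T" for U z
    using vP that by (simp add: P_def)
  have "v \<in> star_set U" if U: "openin T U" "x \<in> U" for U
  proof -
    have "D (U, x) \<subseteq> U" and "U \<subseteq> S"
      using openin_subset[OF U(1)] topspace_subset_S by (auto simp: D_def)
    then show ?thesis
      using v[OF U x] star_set_mono by blast
  qed
  then have "v \<in> halo T x"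
    by (auto simp: halo_def)
  moreover have "v \<in> star_set A"
  proof -
    have "D (topspace T, x) \<subseteq> A" and "A \<subseteq> S"
      using A topspace_subset_S by (auto simp: D_def)
    then show ?thesis
      using v[OF openin_topspace x x] star_set_mono by blast
  qed
  moreover have "v \<notin> topspace T"
  proof
    assume vX: "v \<in> topspace T"
    then have "v \<in> D (topspace T, v)"
      using v[OF openin_topspace x vX] DS standard_mem_star_set_iff topspace_subset_S by blast
    then show False
      by (simp add: D_def)
  qed
  ultimately show ?L by blast
qed

section \<open>Transitivity of the nonstandard diamond\<close>

lemma extension_subset_topspace:
  assumes "\<And>p. \<nu> p \<subseteq> topspace T"
  shows "extension T \<nu> \<phi> \<subseteq> topspace T"
  using assms by (induction \<phi>) auto

lemma extension_Dia_Dia_subset: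
  assumes "\<And>p. \<nu> p \<subseteq> topspace T"
  shows "extension T \<nu> (Dia (Dia \<phi>)) \<subseteq> extension T \<nu> (Dia \<phi>)"
proof
  let ?A = "extension T \<nu> \<phi>"
  let ?B = "extension T \<nu> (Dia \<phi>)"
  fix x
  assume "x \<in> extension T \<nu> (Dia (Dia \<phi>))"
  then have x: "x \<in> topspace T" and meets: "halo T x \<inter> star_set ?B \<noteq> {}"
    unfolding extension.simps(5)[of _ _ "Dia \<phi>"] by blast+
  have A: "?A \<subseteq> topspace T"
    using assms by (rule extension_subset_topspace)
  have B: "?B \<subseteq> S"
    using topspace_subset_S by auto
  have "star_set U \<inter> (star_set ?A - topspace T) \<noteq> {}" if U: "openin T U" "x \<in> U" for U
  proof -
    have "star_set U \<inter> star_set ?B \<noteq> {}"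
      using meets halo_subset_star_set[OF U] by blast
    then have "U \<inter> ?B \<noteq> {}"
      using star_set_disjoint[of U ?B] openin_subset[OF U(1)] topspace_subset_S B by blast
    then obtain y where "y \<in> U" and "halo T y \<inter> (star_set ?A - topspace T) \<noteq> {}"
      by auto
    then show ?thesis
      using halo_subset_star_set[OF U(1)] by blast
  qed
  then show "x \<in> ?B"
    using halo_meets_nonstandard_iff[OF x A] x by simp
qed

end

theorem lemma6p15:
  fixes mem :: "'u \<Rightarrow> 'u \<Rightarrow> bool"
    and At :: "'u set"
    and star :: "'u \<Rightarrow> 'u"
    and T :: "'u topology"
    and rl :: "real \<Rightarrow> 'u"
    and S :: "'u set"
    and \<kappa> :: "'k rel"
    and \<nu> :: "'p \<Rightarrow> 'u set"
    and \<phi> :: "'p modal_formula"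
  assumes model: "polysaturated_model mem At star T rl S \<kappa>"
    and valuation: "\<And>p. \<nu> p \<subseteq> topspace T"
  shows "star_frame.extension mem At star T \<nu> (Dia (Dia \<phi>))
           \<subseteq> star_frame.extension mem At star T \<nu> (Dia \<phi>)"
  using polysaturated_model.extension_Dia_Dia_subset[OF model] valuation .

end
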